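(* Let $A\in\mathrm{M}_n(K)$ be an $n\times n$ matrix over a field $K$. Then the $K$-dimension of the zero-level centralizer of $A$ in $\mathrm{M}_n(K)$ is $$\dim_K\mathrm{Cen}_0(A)=\left[\dim_K(\ker(A))\right]^2.$$
   Context: $\mathrm{Cen}_0(A)=\{C\in\mathrm{M}_n(K)\mid CA=AC=0\}$, and $\ker(A)=\{v\in K^n\mid Av=0\}$, where $A$ acts on column vectors. *)

theory Defs
  imports "HOL-Analysis.Analysis"
begin

text \<open>
  \<^typ>\<open>'a^'n^'n\<close> carries no library scalar multiplication by an arbitrary field:
  \<^const>\<open>scaleR\<close> is restricted to the reals, and \<^term>\<open>(*s)\<close> would multiply each row
  by an element of \<^typ>\<open>'a^'n\<close>.
\<close>

definition mat_scale :: "'a::times \<Rightarrow> 'a^'n^'m \<Rightarrow> 'a^'n^'m"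
  where "mat_scale c A = (\<chi> i j. c * A $ i $ j)"

lemma mat_scale_nth [simp]: "mat_scale c A $ i $ j = c * A $ i $ j"
  by (simp add: mat_scale_def)

interpretation mat_space: vector_space "mat_scale :: 'a::field \<Rightarrow> 'a^'n^'m \<Rightarrow> 'a^'n^'m"
  by unfold_locales (simp_all add: vec_eq_iff algebra_simps)

definition mat_units :: "('a::field^'n^'m) set"
  where "mat_units = range (\<lambda>(i, j). axis i (axis j 1))"

lemma axis_axis_nth:
  "(axis i (axis j x) :: 'a::zero^'n^'m) $ k $ l = (if i = k \<and> j = l then x else 0)"
  by (auto simp: axis_def)

lemma mat_units_sum:
  "(\<Sum>p\<in>UNIV. mat_scale (f p) (axis (fst p) (axis (snd p) 1))) = (\<chi> i j. f (i, j))"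
  for f :: "'m::finite \<times> 'n::finite \<Rightarrow> 'a::field"
proof -
  have "(\<Sum>p\<in>UNIV. f p * (if fst p = i \<and> snd p = j then 1 else 0)) = f (i, j)" for i j
  proof -
    have "(\<Sum>p\<in>UNIV. f p * (if fst p = i \<and> snd p = j then 1 else 0))
        = (\<Sum>p\<in>UNIV. if p = (i, j) then f p else 0)"
      by (rule sum.cong) auto
    then show ?thesis by simp
  qed
  then show ?thesis by (simp add: vec_eq_iff axis_axis_nth)
qed

interpretation mat_space: finite_dimensional_vector_space
  "mat_scale :: 'a::field \<Rightarrow> 'a^'n^'m \<Rightarrow> 'a^'n^'m" mat_units
proof
  let ?E = "\<lambda>p. axis (fst p) (axis (snd p) 1) :: 'a^'n^'m"
  have units: "mat_units = range ?E"
    by (simp add: mat_units_def case_prod_unfold)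
  have inj: "inj ?E"
    by (auto simp: inj_def axis_eq_axis)
  show fin: "finite (mat_units :: ('a^'n^'m) set)"
    by (simp add: units)
  show "mat_space.independent (mat_units :: ('a^'n^'m) set)"
  proof (rule mat_space.independent_if_scalars_zero[OF fin])
    fix f :: "'a^'n^'m \<Rightarrow> 'a" and x :: "'a^'n^'m"
    assume sum0: "(\<Sum>x\<in>mat_units. mat_scale (f x) x) = 0" and x: "x \<in> mat_units"
    have "(\<Sum>p\<in>UNIV. mat_scale (f (?E p)) (?E p)) = 0"
      using sum0 by (simp add: units sum.reindex[OF inj])
    then have "(\<chi> i j. f (?E (i, j))) = 0"
      using mat_units_sum[of "\<lambda>p. f (?E p)"] by simp
    then have "f (?E p) = 0" for p
      by (cases p) (simp add: vec_eq_iff)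
    then show "f x = 0" using x by (auto simp: units)
  qed
  have "A \<in> mat_space.span mat_units" for A :: "'a^'n^'m"
  proof -
    have "A = (\<Sum>p\<in>UNIV. mat_scale (A $ fst p $ snd p) (?E p))"
      using mat_units_sum[of "\<lambda>p. A $ fst p $ snd p"] by (simp add: vec_eq_iff)
    also have "\<dots> \<in> mat_space.span mat_units"
      by (intro mat_space.span_sum mat_space.span_scale mat_space.span_base) (simp add: units)
    finally show ?thesis .
  qed
  then show "mat_space.span (mat_units :: ('a^'n^'m) set) = UNIV" by blast
qed

definition Cen0 :: "'a::field^'n^'n \<Rightarrow> ('a^'n^'n) set"
  where "Cen0 A = {C. C ** A = 0 \<and> A ** C = 0}"

definition mat_ker :: "'a::field^'n^'n \<Rightarrow> ('a^'n) set"
  where "mat_ker A = {v. A *v v = 0}"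

text \<open>
  Since \<^term>\<open>mat_space.dim S\<close> is the dimension of the span of \<^term>\<open>S\<close>, the following two
  facts ensure that the dimensions are those of the sets themselves.
\<close>

lemma subspace_Cen0: "mat_space.subspace (Cen0 A)"
proof (rule mat_space.subspaceI)
  show "0 \<in> Cen0 A"
    by (simp add: Cen0_def vec_eq_iff matrix_matrix_mult_def)
  show "B + C \<in> Cen0 A" if "B \<in> Cen0 A" "C \<in> Cen0 A" for B C
    using that by (simp add: Cen0_def matrix_add_ldistrib vec_eq_iff matrix_matrix_mult_def
        algebra_simps sum.distrib)
  have "mat_scale c C ** A = mat_scale c (C ** A)" "A ** mat_scale c C = mat_scale c (A ** C)"
    for c C
    by (simp_all add: vec_eq_iff matrix_matrix_mult_def sum_distrib_left mult_ac)
  then show "mat_scale c C \<in> Cen0 A" if "C \<in> Cen0 A" for c C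
    using that by (simp add: Cen0_def)
qed

lemma subspace_mat_ker: "vec.subspace (mat_ker A)"
  by (rule vec.subspaceI) (simp_all add: mat_ker_def vec.add vec.scale)

end

theory Submission
  imports Defs
begin

text \<open>
  Read matrices as endomorphisms of \<open>K\<^sup>n\<close>.  A matrix \<open>C\<close> satisfies \<open>A C = 0\<close> iff it maps into
  \<open>ker A\<close>, and \<open>C A = 0\<close> iff it vanishes on the range of \<open>A\<close>.  So the zero-level centralizer
  consists of the linear maps \<open>K\<^sup>n \<rightarrow> ker A\<close> that factor through the cokernel of \<open>A\<close>, and
  its dimension is \<open>dim (coker A) * dim (ker A)\<close>.  For a square matrix the two factors agree by
  rank-nullity.

  Bases make this concrete.  A basis \<open>B\<close> of \<open>ker A\<close> is extended by \<open>E\<close> to a basis of \<open>K\<^sup>n\<close>;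
  then \<open>A\<close> maps \<open>E\<close> injectively to a basis \<open>F\<close> of its range, which is extended by \<open>G\<close> to another
  basis of \<open>K\<^sup>n\<close>.  Both bases have \<open>n\<close> elements, hence \<open>card G = card B\<close>
  (\<open>ex_bases_adapted_to_matrix\<close>).  The matrices that send one \<open>g \<in> G\<close> to one \<open>b \<in> B\<close> and all
  other elements of \<open>F \<union> G\<close> to \<open>0\<close> are the matrix units of this situation; they form a basis of
  the centralizer (\<open>dim_matrices_by_basis_images\<close>).
\<close>

lemma ex_matrix_on_independent:
  fixes f :: "'a::field^'n \<Rightarrow> 'a^'m"
  assumes "vec.independent H"
  shows "\<exists>M::'a^'n^'m. \<forall>x\<in>H. M *v x = f x"
proof -
  obtain h where "Vector_Spaces.linear (*s) (*s) h" "\<forall>x\<in>H. h x = f x"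
    using vec.linear_independent_extend[OF assms] by blast
  then have "\<forall>x\<in>H. matrix h *v x = f x"
    by (simp add: matrix_works)
  then show ?thesis by blast
qed

lemma matrix_eq_on_spanning:
  fixes C D :: "'a::field^'n^'m"
  assumes "vec.span H = UNIV" "\<And>x. x \<in> H \<Longrightarrow> C *v x = D *v x"
  shows "C = D"
proof -
  have "C *v x = D *v x" for x
    by (rule vec.linear_eq_on[OF matrix_vector_mul_linear_gen matrix_vector_mul_linear_gen, of x H])
      (use assms in auto)
  then show ?thesis by (simp add: matrix_eq)
qed

lemma mat_scale_mult_vec: "mat_scale c M *v x = c *s (M *v x)"
  by (simp add: vec_eq_iff matrix_vector_mult_def sum_distrib_left mult.assoc)

lemma sum_mult_vec:
  fixes M :: "'i \<Rightarrow> 'a::field^'n^'m"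
  shows "(\<Sum>i\<in>I. M i) *v x = (\<Sum>i\<in>I. M i *v x)"
  by (induction I rule: infinite_finite_induct) (simp_all add: matrix_vector_mult_add_rdistrib)

text \<open>
  A linear map is determined by arbitrary images of the basis \<open>F \<union> G\<close>, so the space below is
  isomorphic to the space of all functions \<open>G \<rightarrow> span B\<close>.
\<close>

lemma dim_matrices_by_basis_images:
  fixes F G :: "('a::field^'n) set" and B :: "('a^'m) set"
  assumes ind: "vec.independent (F \<union> G)" and span: "vec.span (F \<union> G) = UNIV"
    and disj: "F \<inter> G = {}" and indB: "vec.independent B"
  shows "mat_space.dim {C :: 'a^'n^'m. (\<forall>x\<in>F. C *v x = 0) \<and> (\<forall>x\<in>G. C *v x \<in> vec.span B)}
    = card G * card B"
    (is "mat_space.dim ?V = _")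
proof -
  have finG: "finite G" and finB: "finite B"
    using vec.finiteI_independent[OF ind] vec.finiteI_independent[OF indB] by auto
  have "\<forall>p. \<exists>M::'a^'n^'m. \<forall>x\<in>F \<union> G. M *v x = (if x = fst p then snd p else 0)"
    by (intro allI ex_matrix_on_independent[OF ind])
  then obtain M :: "('a^'n) \<times> ('a^'m) \<Rightarrow> 'a^'n^'m"
    where M: "\<And>p x. x \<in> F \<union> G \<Longrightarrow> M p *v x = (if x = fst p then snd p else 0)"
    by metis
  \<comment> \<open>At \<open>x \<in> G\<close> a linear combination of the \<open>M (g, b)\<close> keeps only the terms with \<open>g = x\<close>.  Spanning
    and independence both reduce to this.\<close>
  have comb: "(\<Sum>p\<in>G \<times> B. mat_scale (c p) (M p)) *v x
      = (if x \<in> G then \<Sum>b\<in>B. c (x, b) *s b else 0)" if "x \<in> F \<union> G" for c x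
  proof -
    have "(\<Sum>p\<in>G \<times> B. mat_scale (c p) (M p)) *v x
        = (\<Sum>(g, b)\<in>G \<times> B. if g = x then c (x, b) *s b else 0)"
      by (auto simp: sum_mult_vec mat_scale_mult_vec M[OF that] intro!: sum.cong)
    also have "\<dots> = (\<Sum>g\<in>G. if g = x then \<Sum>b\<in>B. c (x, b) *s b else 0)"
      by (subst sum.cartesian_product[symmetric]) (auto intro!: sum.cong)
    also have "\<dots> = (if x \<in> G then \<Sum>b\<in>B. c (x, b) *s b else 0)"
      using finG by simp
    finally show ?thesis .
  qed
  have inj: "inj_on M (G \<times> B)"
  proof (rule inj_onI, clarify)
    fix g b g' b'
    assume *: "g \<in> G" "b \<in> B" "g' \<in> G" "b' \<in> B" "M (g, b) = M (g', b')"
    have "b \<noteq> 0" using indB \<open>b \<in> B\<close> vec.dependent_zero by blast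
    moreover have "b = (if g = g' then b' else 0)"
      using M[of g "(g, b)"] M[of g "(g', b')"] * by auto
    ultimately show "g = g' \<and> b = b'" by (auto split: if_splits)
  qed
  have "mat_space.dim ?V = card (M ` (G \<times> B))"
  proof (rule mat_space.dim_unique[OF _ _ _ refl])
    show "M ` (G \<times> B) \<subseteq> ?V"
      using disj by (auto simp: M vec.span_base vec.span_zero)
    show "?V \<subseteq> mat_space.span (M ` (G \<times> B))"
    proof
      fix C assume C: "C \<in> ?V"
      then have "\<forall>x\<in>G. \<exists>u. C *v x = (\<Sum>b\<in>B. u b *s b)"
        by (auto simp: vec.span_finite[OF finB])
      then obtain u where u: "\<And>x. x \<in> G \<Longrightarrow> C *v x = (\<Sum>b\<in>B. u x b *s b)"
        by metis
      have "C = (\<Sum>p\<in>G \<times> B. mat_scale (u (fst p) (snd p)) (M p))"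
        by (rule matrix_eq_on_spanning[OF span], subst comb) (use C u in auto)
      also have "\<dots> \<in> mat_space.span (M ` (G \<times> B))"
        by (intro mat_space.span_sum mat_space.span_scale mat_space.span_base imageI)
      finally show "C \<in> mat_space.span (M ` (G \<times> B))" .
    qed
    show "mat_space.independent (M ` (G \<times> B))"
    proof (rule mat_space.independent_if_scalars_zero)
      show "finite (M ` (G \<times> B))" using finG finB by simp
      fix c y
      assume sum0: "(\<Sum>x\<in>M ` (G \<times> B). mat_scale (c x) x) = 0" and "y \<in> M ` (G \<times> B)"
      then obtain g b where gb: "g \<in> G" "b \<in> B" and y: "y = M (g, b)" by auto
      have "(\<Sum>p\<in>G \<times> B. mat_scale (c (M p)) (M p)) = 0"
        using sum0 by (simp add: sum.reindex[OF inj])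
      then have "(\<Sum>b\<in>B. c (M (g, b)) *s b) = 0"
        using comb[of g "\<lambda>p. c (M p)"] gb by simp
      then show "c y = 0"
        using vec.independentD[OF indB finB subset_refl, of "\<lambda>b. c (M (g, b))"] gb y by simp
    qed
  qed
  then show ?thesis
    by (simp add: card_image[OF inj] card_cartesian_product)
qed

text \<open>
  The coordinates of \<open>x\<close> in the basis \<open>B \<union> E\<close> are supported in \<open>B\<close> and also in \<open>E\<close>.
\<close>

lemma span_Int_span_eq_0:
  fixes B E :: "('a::field^'n) set"
  assumes "vec.independent (B \<union> E)" "B \<inter> E = {}" "x \<in> vec.span B" "x \<in> vec.span E"
  shows "x = 0"
proof -
  have reps: "vec.representation (B \<union> E) x = vec.representation B x"
      "vec.representation (B \<union> E) x = vec.representation E x"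
    using assms by (auto intro!: vec.representation_extend)
  have "vec.representation (B \<union> E) x b = 0" for b
    using reps vec.representation_ne_zero[of B x b] vec.representation_ne_zero[of E x b] assms(2)
    by (metis disjoint_iff)
  moreover have "x \<in> vec.span (B \<union> E)"
    using assms(3) vec.span_mono[of B "B \<union> E"] by blast
  ultimately show ?thesis
    using vec.sum_nonzero_representation_eq[OF assms(1), of x] by simp
qed

text \<open>
  Rank-nullity in terms of bases: \<open>B\<close> spans the kernel, \<open>F\<close> the range, and \<open>G\<close> a complement of
  the range.  The two bases of \<open>K\<^sup>n\<close> whose cardinalities are compared are the extension of \<open>B\<close>
  by vectors that \<open>A\<close> maps bijectively onto \<open>F\<close>, and \<open>F \<union> G\<close>.
\<close>

lemma ex_bases_adapted_to_matrix:
  fixes A :: "'a::field^'n^'n"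
  obtains B F G where
    "vec.independent B" "vec.span B = mat_ker A"
    "vec.span F = range ((*v) A)" "F \<inter> G = {}"
    "vec.independent (F \<union> G)" "vec.span (F \<union> G) = UNIV"
    "card G = card B"
proof -
  obtain B where B: "B \<subseteq> mat_ker A" "vec.independent B" "mat_ker A \<subseteq> vec.span B"
    using vec.maximal_independent_subset by blast
  have spanB: "vec.span B = mat_ker A"
    using B vec.span_minimal[OF B(1) subspace_mat_ker] by blast
  obtain H where H: "B \<subseteq> H" "vec.independent H" "vec.span H = UNIV"
    using vec.maximal_independent_subset_extend[OF subset_UNIV B(2)]
    by (metis subset_UNIV subset_antisym)
  define E where "E = H - B"
  have BE: "B \<inter> E = {}" "B \<union> E = H" using H by (auto simp: E_def)
  have finH: "finite H" using vec.finiteI_independent[OF H(2)] .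
  have indE: "vec.independent E"
    using vec.independent_mono[OF H(2)] BE by blast
  \<comment> \<open>The span of \<open>E\<close> is a complement of the kernel, so \<open>A\<close> is injective on it.\<close>
  have inj: "inj_on ((*v) A) (vec.span E)"
  proof -
    have "x = 0" if "x \<in> vec.span E" "A *v x = 0" for x
    proof (rule span_Int_span_eq_0)
      show "vec.independent (B \<union> E)" "B \<inter> E = {}" using H(2) BE by simp_all
      show "x \<in> vec.span B" using that by (simp add: spanB mat_ker_def)
    qed fact
    then show ?thesis
      by (simp add: vec.linear_inj_on_iff_eq_0[OF matrix_vector_mul_linear_gen vec.subspace_span])
  qed
  define F where "F = (*v) A ` E"
  have indF: "vec.independent F"
    unfolding F_def
    by (rule vec.linear_independent_injective_image[OF matrix_vector_mul_linear_gen indE inj])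
  have cardF: "card F = card E"
    unfolding F_def using inj_on_subset[OF inj vec.span_superset] by (rule card_image)
  have "range ((*v) A) = vec.span ((*v) A ` H)"
    using vec.span_image[of A H] H(3) by simp
  also have "\<dots> = vec.span F"
  proof -
    have "(*v) A ` H \<subseteq> insert 0 F" "F \<subseteq> (*v) A ` H"
      using B(1) BE by (auto simp: F_def mat_ker_def)
    then show ?thesis
      by (metis vec.span_insert_0 vec.span_mono subset_antisym)
  qed
  finally have spanF: "vec.span F = range ((*v) A)" by simp
  obtain H' where H': "F \<subseteq> H'" "vec.independent H'" "vec.span H' = UNIV"
    using vec.maximal_independent_subset_extend[OF subset_UNIV indF]
    by (metis subset_UNIV subset_antisym)
  have finH': "finite H'" using vec.finiteI_independent[OF H'(2)] .
  have "card H = card H'"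
    by (metis H(2,3) H'(2,3) vec.dim_span_eq_card_independent)
  then have "card (H' - F) = card B"
    using finH finH' H(1) H'(1) cardF card_mono[OF finH H(1)]
    by (simp add: card_Diff_subset finite_subset E_def)
  then show ?thesis
    using that[OF B(2) spanB spanF, of "H' - F"] H' by (simp add: Un_absorb1)
qed

lemma Cen0_eq_kernel_conditions:
  "Cen0 A = {C. (\<forall>x\<in>range ((*v) A). C *v x = 0) \<and> (\<forall>x. C *v x \<in> mat_ker A)}"
  by (auto simp: Cen0_def mat_ker_def matrix_eq matrix_vector_mul_assoc)

theorem corollary4p2:
  fixes A :: "'a::field^'n^'n"
  shows "mat_space.dim (Cen0 A) = (vec.dim (mat_ker A))\<^sup>2"
proof -
  obtain B F G where B: "vec.independent B" "vec.span B = mat_ker A"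
    and F: "vec.span F = range ((*v) A)" and disj: "F \<inter> G = {}"
    and FG: "vec.independent (F \<union> G)" "vec.span (F \<union> G) = UNIV"
    and card: "card G = card B"
    by (rule ex_bases_adapted_to_matrix[of A])
  have range0: "(\<forall>x\<in>range ((*v) A). C *v x = 0) \<longleftrightarrow> (\<forall>x\<in>F. C *v x = 0)" for C :: "'a^'n^'n"
    using vec.span_minimal[OF _ subspace_mat_ker, of F C] vec.span_superset[of F]
    by (auto simp: F[symmetric] mat_ker_def)
  have into: "(\<forall>x. C *v x \<in> mat_ker A) \<longleftrightarrow> (\<forall>x\<in>G. C *v x \<in> vec.span B)"
    if C: "\<forall>x\<in>F. C *v x = 0" for C :: "'a^'n^'n"
  proof
    assume "\<forall>x\<in>G. C *v x \<in> vec.span B"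
    with C have "(*v) C ` (F \<union> G) \<subseteq> mat_ker A"
      using B(2) vec.span_zero[of B] by auto
    then have "vec.span ((*v) C ` (F \<union> G)) \<subseteq> mat_ker A"
      by (rule vec.span_minimal[OF _ subspace_mat_ker])
    then show "\<forall>x. C *v x \<in> mat_ker A"
      using vec.span_image[of C "F \<union> G"] FG(2) by auto
  qed (simp add: B(2))
  have "Cen0 A = {C. (\<forall>x\<in>F. C *v x = 0) \<and> (\<forall>x\<in>G. C *v x \<in> vec.span B)}"
    unfolding Cen0_eq_kernel_conditions range0 using into by blast
  then have "mat_space.dim (Cen0 A) = card B * card B"
    using dim_matrices_by_basis_images[OF FG disj B(1)] card by simp
  moreover have "vec.dim (mat_ker A) = card B"
    using vec.dim_span_eq_card_independent[OF B(1)] B(2) by simp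
  ultimately show ?thesis by (simp add: power2_eq_square)
qed

end
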